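(* Let $n\ge 2$. There are noncongruent convex bodies $K$ and $L$ in $\mathbb{R}^n$ such that for all integers $i$ and $k$ with $1\le i\le k\le n-1$ we have $$V_i(K\cap H)=V_i(L\cap H)\qquad\text{for all } H\in G(n,k).$$ Moreover, $K$ and $L$ can be constructed in such a way that both of them are $C^\infty_+$ bodies of revolution; and they can also be constructed in such a way that both of them are polytopes.
   Context: A convex body in $\mathbb{R}^n$ is a compact convex set with nonempty interior; throughout, convex bodies are assumed to contain the origin in their interiors. $G(n,k)$ is the Grassmannian of all $k$-dimensional linear subspaces of $\mathbb{R}^n$. Two sets $C,D\subset\mathbb{R}^n$ are congruent if there is an isometry $T$ of $\mathbb{R}^n$ with $T(C)=D$. For a compact convex set $K\subset\mathbb{R}^n$, the intrinsic volumes $V_i(K)$ are defined by Steiner's formula $$\mathrm{vol}_n(K+\epsilon B_2^n)=\sum_{i=0}^n \kappa_{n-i}V_i(K)\epsilon^{n-i},\qquad \epsilon\ge 0,$$ where $+$ is Minkowski addition, $B_2^n$ is the closed unit Euclidean ball in $\mathbb{R}^n$, and $\kappa_{m}$ is the volume of the $m$-dimensional Euclidean unit ball. A convex body is of class $C^\infty_+$ if its boundary is a $C^\infty$ manifold in $\mathbb{R}^n$ with positive Gaussian curvature at each point. A body of revolution is a convex body that is rotationally symmetric about some line (invariant under all isometries of $\mathbb{R}^n$ that fix that line pointwise). *)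

theory Defs
  imports "HOL-Analysis.Analysis"
begin

section \<open>Convex bodies and congruence\<close>

text \<open>Following the convention of the source, a convex body contains the origin in its interior;
  in particular its interior is nonempty.\<close>

definition convex_body :: "'a::euclidean_space set \<Rightarrow> bool" where
  "convex_body K \<longleftrightarrow> compact K \<and> convex K \<and> 0 \<in> interior K"

text \<open>Surjectivity need not be required: it is automatic in finite dimension.\<close>

definition isometry :: "('a::euclidean_space \<Rightarrow> 'a) \<Rightarrow> bool" where
  "isometry T \<longleftrightarrow> (\<forall>x y. dist (T x) (T y) = dist x y)"

definition congruent_sets :: "'a::euclidean_space set \<Rightarrow> 'a set \<Rightarrow> bool" where
  "congruent_sets C D \<longleftrightarrow> (\<exists>T. isometry T \<and> T ` C = D)"

definition body_of_revolution :: "'a::euclidean_space set \<Rightarrow> bool" where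
  "body_of_revolution K \<longleftrightarrow> convex_body K \<and>
     (\<exists>a u. u \<noteq> 0 \<and>
        (\<forall>T. isometry T \<and> (\<forall>t. T (a + t *\<^sub>R u) = a + t *\<^sub>R u) \<longrightarrow> T ` K = K))"

section \<open>Intrinsic volumes\<close>

text \<open>Minkowski sums are those of \<open>HOL-Library.Set_Algebras\<close>, and \<open>unit_ball_vol m\<close> is the volume
  of the unit ball in dimension \<open>m\<close>. The coefficients are unique because Steiner's formula is a
  polynomial identity in \<open>\<epsilon>\<close> and \<open>unit_ball_vol m > 0\<close>; those of index beyond the dimension do not
  occur in the formula and are set to \<open>0\<close>. For nonempty compact convex sets the coefficients exist
  by Steiner's theorem, and for the empty set they are all \<open>0\<close>.\<close>

definition steiner_coeffs :: "'a::euclidean_space set \<Rightarrow> (nat \<Rightarrow> real) \<Rightarrow> bool" where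
  "steiner_coeffs K V \<longleftrightarrow>
     (\<forall>i>DIM('a). V i = 0) \<and>
     (\<forall>\<epsilon>\<ge>0. measure lebesgue (K + (*\<^sub>R) \<epsilon> ` cball 0 1) =
        (\<Sum>i\<le>DIM('a). unit_ball_vol (real (DIM('a) - i)) * V i * \<epsilon> ^ (DIM('a) - i)))"

definition intrinsic_volume :: "nat \<Rightarrow> 'a::euclidean_space set \<Rightarrow> real" where
  "intrinsic_volume i K = (THE V. steiner_coeffs K V) i"

section \<open>Smooth bodies of positive curvature\<close>

text \<open>\<open>Ck_on k f U\<close>: the function \<open>f\<close> is \<open>k\<close> times continuously differentiable on the open
  set \<open>U\<close>, expressed through iterated directional derivatives.\<close>

primrec Ck_on :: "nat \<Rightarrow> ('a::euclidean_space \<Rightarrow> real) \<Rightarrow> 'a set \<Rightarrow> bool" where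
  "Ck_on 0 f U \<longleftrightarrow> continuous_on U f"
| "Ck_on (Suc k) f U \<longleftrightarrow>
     (\<forall>x\<in>U. f differentiable (at x)) \<and> (\<forall>v. Ck_on k (\<lambda>x. frechet_derivative f (at x) v) U)"

definition smooth_on :: "('a::euclidean_space \<Rightarrow> real) \<Rightarrow> 'a set \<Rightarrow> bool" where
  "smooth_on f U \<longleftrightarrow> (\<forall>k. Ck_on k f U)"

text \<open>A \<open>C\<^sup>\<infinity>\<close> submanifold of codimension one: locally a regular zero set of a smooth function.\<close>

definition smooth_hypersurface :: "'a::euclidean_space set \<Rightarrow> bool" where
  "smooth_hypersurface M \<longleftrightarrow>
     (\<forall>p\<in>M. \<exists>U f. open U \<and> p \<in> U \<and> smooth_on f U \<and> M \<inter> U = {x \<in> U. f x = 0} \<and>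
        (\<forall>x\<in>M \<inter> U. \<exists>v. frechet_derivative f (at x) v \<noteq> 0))"

text \<open>\<open>gauss_map K \<nu>\<close>: on the boundary of the convex body \<open>K\<close>, the field \<open>\<nu>\<close> is the outer unit
  normal. It is unique on the boundary if that is smooth; off the boundary it is arbitrary.\<close>

definition gauss_map :: "'a::euclidean_space set \<Rightarrow> ('a \<Rightarrow> 'a) \<Rightarrow> bool" where
  "gauss_map K \<nu> \<longleftrightarrow> (\<forall>x\<in>frontier K. norm (\<nu> x) = 1 \<and> (\<forall>y\<in>K. \<nu> x \<bullet> (y - x) \<le> 0))"

text \<open>The Gaussian curvature at a boundary point \<open>p\<close> is the determinant of the Weingarten map, the
  differential \<open>W\<close> of the Gauss map on the tangent space orthogonal to \<open>\<nu> p\<close>. As the derivative is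
  taken within the boundary, \<open>W\<close> is determined only on that tangent space, which it maps to itself.
  The determinant there equals the one on the whole space after precomposing \<open>W\<close> with
  the orthogonal projection onto the tangent space and letting the normal be an eigenvector of
  eigenvalue \<open>1\<close>. With the outer normal, the principal curvatures of a convex body are nonnegative;
  for a ball of radius \<open>r\<close> they are \<open>1 / r\<close>.\<close>

definition has_gaussian_curvature :: "(real ^ 'n) set \<Rightarrow> real ^ 'n \<Rightarrow> real \<Rightarrow> bool" where
  "has_gaussian_curvature K p c \<longleftrightarrow>
     (\<exists>\<nu> W. gauss_map K \<nu> \<and> (\<nu> has_derivative W) (at p within frontier K) \<and>
        c = det (matrix (\<lambda>v. W (v - (v \<bullet> \<nu> p) *\<^sub>R \<nu> p) + (v \<bullet> \<nu> p) *\<^sub>R \<nu> p)))"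

definition C_infinity_plus :: "(real ^ 'n) set \<Rightarrow> bool" where
  "C_infinity_plus K \<longleftrightarrow> convex_body K \<and> smooth_hypersurface (frontier K) \<and>
     (\<forall>p\<in>frontier K. \<exists>c>0. has_gaussian_curvature K p c)"

section \<open>Central sections with equal intrinsic volumes\<close>

definition grassmannian :: "nat \<Rightarrow> 'a::euclidean_space set set" where
  "grassmannian k = {H. subspace H \<and> dim H = k}"

definition noncongruent_with_equal_sections :: "'a::euclidean_space set \<Rightarrow> 'a set \<Rightarrow> bool" where
  "noncongruent_with_equal_sections K L \<longleftrightarrow>
     convex_body K \<and> convex_body L \<and> \<not> congruent_sets K L \<and>
     (\<forall>i k. 1 \<le> i \<and> i \<le> k \<and> k \<le> DIM('a) - 1 \<longrightarrow>
        (\<forall>H\<in>grassmannian k. intrinsic_volume i (K \<inter> H) = intrinsic_volume i (L \<inter> H)))"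

end

theory Submission
  imports Defs
begin

text \<open>The volume of the outer parallel set \<open>X + \<epsilon> B\<close> of a compact set \<open>X\<close> is invariant under reflection
  in the origin, and it is a valuation: it is additive, in the sense of inclusion-exclusion, on pairs
  of compact sets with convex union (\<open>parallel_volume_Int\<close>). Suppose that \<open>A\<close> and \<open>C\<close> are
  compact and that \<open>A \<union> C = A \<union> - C\<close> is convex. Intersecting with a subspace \<open>H\<close> keeps all of this, so
  the sections of \<open>K = A \<inter> C\<close> and \<open>L = A \<inter> - C\<close> by \<open>H\<close> have the same parallel volumes for
  all \<open>\<epsilon>\<close>, hence the same intrinsic volumes of every order (\<open>intrinsic_volume_reflected_cut\<close>). In
  pictures: make two disjoint cuts in a centrally symmetric body, and get \<open>L\<close> from \<open>K\<close> by moving the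
  second cut to the antipodal place.

  For noncongruence, the symmetric body contains two opposite points at maximal distance from the
  origin that neither cut of \<open>K\<close> touches. They force any isometry from \<open>K\<close> onto \<open>L\<close> to be linear, so it
  preserves inner products among the removed points. The two cuts of \<open>K\<close> are close together, so these
  products are nonnegative, whereas \<open>L\<close> has removed points on opposite sides
  (\<open>not_congruent_if_opposite_cuts\<close>).

  The smooth bodies are dented unit balls \<open>{x. |x|\<^sup>2 + \<phi> (x \<bullet> e) \<le> 1}\<close> with a smooth, nonnegative
  profile \<open>\<phi>\<close>. Intersecting two of them whose profiles have disjoint supports adds the profiles, and their
  union is the ball. If \<open>\<bar>\<phi>''\<bar> \<le> 1\<close>, the defining function has a positive definite Hessian, which gives
  convexity and positive Gaussian curvature (\<open>C_infinity_plus_dented_ball\<close>). The polytopes are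
  the product of a hexagon and a cube, with two faces of codimension two cut off
  (\<open>exists_polytope_pair\<close>).\<close>

section \<open>Parallel volumes and intrinsic volumes of sections\<close>

abbreviation outer_parallel :: "real \<Rightarrow> 'a::euclidean_space set \<Rightarrow> 'a set" where
  "outer_parallel \<epsilon> X \<equiv> X + (*\<^sub>R) \<epsilon> ` cball 0 1"

lemma mem_outer_parallel:
  fixes X :: "'a::euclidean_space set"
  assumes "\<epsilon> \<ge> 0"
  shows "z \<in> outer_parallel \<epsilon> X \<longleftrightarrow> (\<exists>x\<in>X. dist z x \<le> \<epsilon>)"
proof
  assume "z \<in> outer_parallel \<epsilon> X"
  then obtain x y where "x \<in> X" "norm y \<le> 1" "z = x + \<epsilon> *\<^sub>R y"
    by (auto simp: set_plus_def)
  then have "dist z x \<le> \<epsilon>"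
    using assms by (simp add: dist_norm mult_left_le)
  with \<open>x \<in> X\<close> show "\<exists>x\<in>X. dist z x \<le> \<epsilon>" by blast
next
  assume "\<exists>x\<in>X. dist z x \<le> \<epsilon>"
  then obtain x where x: "x \<in> X" "dist z x \<le> \<epsilon>" by blast
  have "z - x \<in> (*\<^sub>R) \<epsilon> ` cball 0 1"
  proof (cases "\<epsilon> = 0")
    case True
    then show ?thesis using x by (auto intro: image_eqI[of _ _ 0])
  next
    case False
    then show ?thesis
      using x assms cball_scale[of \<epsilon> "0::'a" 1] by (auto simp: dist_norm)
  qed
  then show "z \<in> outer_parallel \<epsilon> X"
    using x(1) set_plus_intro[of x X "z - x"] by simp
qed

lemma outer_parallel_Un:
  fixes A C :: "'a::euclidean_space set"
  shows "outer_parallel \<epsilon> (A \<union> C) = outer_parallel \<epsilon> A \<union> outer_parallel \<epsilon> C"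
  by (auto simp: set_plus_def)

text \<open>Nearest points of \<open>A\<close> and \<open>C\<close> to \<open>z\<close> are joined by a segment inside the convex union. The
  segment is connected and covered by two closed sets, so it meets \<open>A \<inter> C\<close>, and it stays within
  distance \<open>\<epsilon>\<close> of \<open>z\<close>.\<close>

lemma outer_parallel_Int:
  fixes A C :: "'a::euclidean_space set"
  assumes "closed A" "closed C" "convex (A \<union> C)" and \<epsilon>: "\<epsilon> \<ge> 0"
  shows "outer_parallel \<epsilon> (A \<inter> C) = outer_parallel \<epsilon> A \<inter> outer_parallel \<epsilon> C"
proof (intro equalityI subsetI)
  fix z assume "z \<in> outer_parallel \<epsilon> A \<inter> outer_parallel \<epsilon> C"
  then obtain a c where a: "a \<in> A" "dist z a \<le> \<epsilon>" and c: "c \<in> C" "dist z c \<le> \<epsilon>"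
    using \<epsilon> by (auto simp: mem_outer_parallel)
  have "closed_segment a c \<subseteq> A \<union> C"
    using a c assms(3) by (simp add: closed_segment_subset)
  then obtain x where x: "x \<in> closed_segment a c" "x \<in> A" "x \<in> C"
    using connected_segment(1)[of a c] a(1) c(1) assms(1,2)
    unfolding connected_closed by blast
  have "closed_segment a c \<subseteq> cball z \<epsilon>"
    using a c by (simp add: closed_segment_subset)
  then show "z \<in> outer_parallel \<epsilon> (A \<inter> C)"
    using x \<epsilon> by (auto simp: mem_outer_parallel intro!: bexI[of _ x])
qed (use \<epsilon> in \<open>auto simp: mem_outer_parallel\<close>)

lemma compact_outer_parallel:
  fixes X :: "'a::euclidean_space set"
  assumes "compact X"
  shows "compact (outer_parallel \<epsilon> X)"
  using compact_sums'[OF assms compact_scaling[OF compact_cball[of "0::'a" 1], of \<epsilon>]]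
  by (rule back_subst[of compact]) (auto simp: set_plus_def)

text \<open>The valuation property of the parallel volume: by the lemmas on unions and intersections it is
  inclusion-exclusion for Lebesgue measure.\<close>

lemma parallel_volume_Int:
  fixes A C :: "'a::euclidean_space set"
  assumes "compact A" "compact C" "convex (A \<union> C)" "\<epsilon> \<ge> 0"
  shows "measure lebesgue (outer_parallel \<epsilon> (A \<inter> C)) =
    measure lebesgue (outer_parallel \<epsilon> A) + measure lebesgue (outer_parallel \<epsilon> C)
      - measure lebesgue (outer_parallel \<epsilon> (A \<union> C))"
proof -
  have "outer_parallel \<epsilon> (A \<inter> C) = outer_parallel \<epsilon> A \<inter> outer_parallel \<epsilon> C"
    using assms by (intro outer_parallel_Int compact_imp_closed)
  moreover have "outer_parallel \<epsilon> A \<in> lmeasurable" "outer_parallel \<epsilon> C \<in> lmeasurable"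
    using assms by (intro lmeasurable_compact compact_outer_parallel; simp)+
  ultimately show ?thesis
    using outer_parallel_Un[of A C \<epsilon>] by (simp add: measure_Un3)
qed

lemma parallel_volume_uminus:
  fixes X :: "'a::euclidean_space set"
  assumes "\<epsilon> \<ge> 0"
  shows "measure lebesgue (outer_parallel \<epsilon> (uminus ` X)) = measure lebesgue (outer_parallel \<epsilon> X)"
proof -
  have "z \<in> outer_parallel \<epsilon> (uminus ` X) \<longleftrightarrow> - z \<in> outer_parallel \<epsilon> X" for z
  proof -
    have "dist z (- x) = dist (- z) x" for x
      using dist_minus[of "- z" x] by simp
    then show ?thesis using assms by (simp add: mem_outer_parallel)
  qed
  then have "outer_parallel \<epsilon> (uminus ` X) = uminus ` outer_parallel \<epsilon> X"
    by (metis (no_types, lifting) image_iff minus_minus equalityI subsetI)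
  then show ?thesis
    using measure_lebesgue_affine[of "-1" 0 "outer_parallel \<epsilon> X"] by simp
qed

text \<open>Steiner's formula involves a set only through its parallel volumes, so the two sets have the same
  coefficient sequences.\<close>

lemma intrinsic_volume_eqI:
  fixes X Y :: "'a::euclidean_space set"
  assumes "\<And>\<epsilon>. \<epsilon> \<ge> 0 \<Longrightarrow>
    measure lebesgue (outer_parallel \<epsilon> X) = measure lebesgue (outer_parallel \<epsilon> Y)"
  shows "intrinsic_volume i X = intrinsic_volume i Y"
proof -
  have "steiner_coeffs X = steiner_coeffs Y"
    unfolding steiner_coeffs_def fun_eq_iff using assms by simp
  then show ?thesis by (simp add: intrinsic_volume_def)
qed

text \<open>Inclusion-exclusion expresses the parallel volume of either section through those of \<open>A \<inter> H\<close>, of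
  \<open>(A \<union> C) \<inter> H\<close>, and of the section of \<open>C\<close> or of \<open>- C\<close>. These last two sections are reflections of
  each other in the origin, because \<open>H\<close> is symmetric.\<close>

lemma intrinsic_volume_reflected_cut:
  fixes A C :: "'a::euclidean_space set"
  assumes "compact A" "compact C" "convex (A \<union> C)" "A \<union> uminus ` C = A \<union> C" "subspace H"
  shows "intrinsic_volume i (A \<inter> C \<inter> H) = intrinsic_volume i (A \<inter> uminus ` C \<inter> H)"
proof (rule intrinsic_volume_eqI)
  fix \<epsilon> :: real assume \<epsilon>: "\<epsilon> \<ge> 0"
  let ?vol = "\<lambda>X. measure lebesgue (outer_parallel \<epsilon> X)"
  have H: "closed H" "convex H"
    using assms(5) by (auto simp: closed_subspace subspace_imp_convex)
  have *: "?vol (A \<inter> D \<inter> H) = ?vol (A \<inter> H) + ?vol (D \<inter> H) - ?vol ((A \<union> D) \<inter> H)"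
    if "compact D" "convex (A \<union> D)" for D
  proof -
    have "convex ((A \<inter> H) \<union> (D \<inter> H))"
      using convex_Int[OF that(2) H(2)] by (simp add: Int_Un_distrib2)
    moreover have "A \<inter> D \<inter> H = (A \<inter> H) \<inter> (D \<inter> H)" by blast
    moreover have "(A \<union> D) \<inter> H = (A \<inter> H) \<union> (D \<inter> H)" by blast
    ultimately show ?thesis
      using assms(1) that(1) H \<epsilon> by (simp add: parallel_volume_Int compact_Int_closed)
  qed
  have "uminus ` C \<inter> H = uminus ` (C \<inter> H)"
    using subspace_neg[OF assms(5)] by (auto intro!: image_eqI[where x = "- _"])
  then have "?vol (uminus ` C \<inter> H) = ?vol (C \<inter> H)"
    by (simp only: parallel_volume_uminus[OF \<epsilon>])
  then show "?vol (A \<inter> C \<inter> H) = ?vol (A \<inter> uminus ` C \<inter> H)"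
    using *[of C] *[of "uminus ` C"] assms(2-4) by (simp add: compact_negations)
qed

section \<open>Detecting noncongruence\<close>

text \<open>Two points at distance \<open>2 R\<close> in a ball of radius \<open>R\<close> are antipodal. So \<open>T p\<close> and \<open>T (- p)\<close> are
  opposite, and the isometry \<open>T\<close> carries the midpoint of \<open>p\<close> and \<open>- p\<close> to their midpoint, which is \<open>0\<close>.\<close>

lemma isometry_fixes_center:
  fixes T :: "'a::euclidean_space \<Rightarrow> 'a"
  assumes T: "isometry T" and "norm (T p) \<le> norm p" "norm (T (- p)) \<le> norm p"
  shows "T 0 = 0"
proof -
  have d: "norm (T x - T y) = norm (x - y)" for x y
    using T by (simp add: isometry_def dist_norm)
  define a b c where "a = T p" and "b = T (- p)" and "c = T 0"
  have "norm (a - b) = 2 * norm p" "norm (c - a) = norm p" "norm (c - b) = norm p"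
    using d[of p "- p"] d[of 0 p] d[of 0 "- p"]
    by (simp_all add: a_def b_def c_def flip: scaleR_2)
  then have ab: "(a - b) \<bullet> (a - b) = 4 * (p \<bullet> p)" and
    ca: "(c - a) \<bullet> (c - a) = p \<bullet> p" and cb: "(c - b) \<bullet> (c - b) = p \<bullet> p"
    by (simp_all add: power_mult_distrib flip: power2_norm_eq_inner)
  have le: "a \<bullet> a \<le> p \<bullet> p" "b \<bullet> b \<le> p \<bullet> p"
    using assms(2,3) by (simp_all add: norm_le a_def b_def)
  have "(a + b) \<bullet> (a + b) + (a - b) \<bullet> (a - b) = 2 * (a \<bullet> a) + 2 * (b \<bullet> b)"
    by (simp add: inner_diff inner_add inner_commute)
  then have "(a + b) \<bullet> (a + b) \<le> 0" using ab le by simp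
  then have "a + b = 0" by (metis inner_eq_zero_iff inner_ge_zero antisym)
  then have b: "b = - a" by (simp add: add_eq_0_iff)
  have "a \<bullet> a = p \<bullet> p"
    using ab unfolding b by (simp add: inner_diff inner_add inner_commute)
  then have "c \<bullet> c = 0"
    using ca cb unfolding b by (simp add: inner_diff inner_add inner_commute)
  then show ?thesis by (simp add: c_def)
qed

text \<open>The points \<open>x \<notin> K\<close> with \<open>- x \<in> K\<close> are those that a cut removed from the symmetric body
  \<open>K \<union> - K\<close>. Because of \<open>p\<close>, an isometry onto \<open>L\<close> fixes the origin, so it is linear and orthogonal; it then carries the
  removed points of \<open>K\<close> to those of \<open>L\<close> and preserves the inner products among them. Having two
  removed points at an obtuse angle is therefore invariant under congruence.\<close>

lemma not_congruent_if_opposite_cuts: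
  fixes K L :: "'a::euclidean_space set"
  assumes p: "p \<in> K" "- p \<in> K" and L: "L \<subseteq> cball 0 (norm p)"
    and K: "\<And>x y. \<lbrakk>x \<notin> K; - x \<in> K; y \<notin> K; - y \<in> K\<rbrakk> \<Longrightarrow> x \<bullet> y \<ge> 0"
    and xy: "x \<notin> L" "- x \<in> L" "y \<notin> L" "- y \<in> L" "x \<bullet> y < 0"
  shows "\<not> congruent_sets K L"
proof
  assume "congruent_sets K L"
  then obtain T where T: "isometry T" and L_eq: "L = T ` K"
    by (auto simp: congruent_sets_def)
  have "T 0 = 0"
    using p L unfolding L_eq by (intro isometry_fixes_center[OF T, of p]) auto
  then have orth: "orthogonal_transformation T"
    using T by (simp add: orthogonal_transformation_isometry isometry_def)
  then have lin: "linear T" and "inj T" "surj T"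
    by (simp_all add: orthogonal_transformation_linear orthogonal_transformation_inj
        orthogonal_transformation_surj)
  have mem: "T z \<in> L \<longleftrightarrow> z \<in> K" for z
    unfolding L_eq using \<open>inj T\<close> by (simp add: inj_image_mem_iff)
  obtain x' y' where x': "x = T x'" and y': "y = T y'"
    using \<open>surj T\<close> by (metis surjD)
  have "x' \<bullet> y' \<ge> 0"
    using K[of x' y'] xy(1-4) mem[of x'] mem[of y'] mem[of "- x'"] mem[of "- y'"] lin
    by (simp add: x' y' linear_neg)
  then show False
    using xy(5) orth by (simp add: x' y' orthogonal_transformation_def)
qed

lemma noncongruent_with_equal_sectionsI:
  fixes A C :: "'a::euclidean_space set"
  assumes bodies: "convex_body (A \<inter> C)" "convex_body (A \<inter> uminus ` C)"
    and "compact A" "compact C" "convex (A \<union> C)" "A \<union> uminus ` C = A \<union> C"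
    and "\<not> congruent_sets (A \<inter> C) (A \<inter> uminus ` C)"
  shows "noncongruent_with_equal_sections (A \<inter> C) (A \<inter> uminus ` C)"
  using assms intrinsic_volume_reflected_cut[OF assms(3-6)]
  by (simp add: noncongruent_with_equal_sections_def grassmannian_def)

section \<open>Smooth functions and flat bumps\<close>

text \<open>Coinduction for smoothness: a class of functions that is closed under directional derivatives
  consists of smooth functions.\<close>

lemma smooth_onI_closed_class:
  fixes P :: "('a::euclidean_space \<Rightarrow> real) \<Rightarrow> bool"
  assumes deriv: "\<And>f. P f \<Longrightarrow> \<exists>f'. (\<forall>x. (f has_derivative f' x) (at x)) \<and> (\<forall>v. P (\<lambda>x. f' x v))"
    and "P f"
  shows "smooth_on f U"
proof -
  have "Ck_on k f U" if "P f" for k f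
    using that
  proof (induction k arbitrary: f)
    case 0
    then obtain f' where "\<And>x. (f has_derivative f' x) (at x)" using deriv by blast
    then show ?case
      by (auto intro!: continuous_at_imp_continuous_on has_derivative_continuous)
  next
    case (Suc k)
    then obtain f' where f': "\<And>x. (f has_derivative f' x) (at x)" "\<And>v. P (\<lambda>x. f' x v)"
      using deriv by blast
    moreover have "frechet_derivative f (at x) = f' x" for x
      using f'(1) by (metis frechet_derivative_at)
    ultimately show ?case
      using Suc.IH by (auto simp: differentiable_def)
  qed
  with \<open>P f\<close> show ?thesis by (simp add: smooth_on_def)
qed

text \<open>Smoothness of \<open>D 0\<close> on the line, with the successive derivatives kept as data.\<close>

definition derivative_tower :: "(nat \<Rightarrow> real \<Rightarrow> real) \<Rightarrow> bool" where
  "derivative_tower D \<longleftrightarrow> (\<forall>k t. (D k has_real_derivative D (Suc k) t) (at t))"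

lemma derivative_towerD:
  "derivative_tower D \<Longrightarrow> (D k has_real_derivative D (Suc k) t) (at t)"
  by (simp add: derivative_tower_def)

lemma has_derivative_ridge:
  fixes e :: "'a::euclidean_space"
  assumes "derivative_tower D"
  shows "((\<lambda>x. D k (x \<bullet> e)) has_derivative (\<lambda>v. D (Suc k) (x \<bullet> e) * (v \<bullet> e))) (at x)"
  using has_derivative_compose[of "\<lambda>x. x \<bullet> e" "\<lambda>v. v \<bullet> e" x UNIV "D k", OF _
      derivative_towerD[OF assms, of k "x \<bullet> e", unfolded has_field_derivative_def]]
  by (simp add: bounded_linear_imp_has_derivative bounded_linear_inner_left)

lemma smooth_on_norm2_plus_ridge:
  fixes e :: "'a::euclidean_space"
  assumes D: "derivative_tower D"
  shows "smooth_on (\<lambda>x. x \<bullet> x + D 0 (x \<bullet> e) + b) U"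
proof (rule smooth_onI_closed_class[where P =
      "\<lambda>f. \<exists>a w c k b. f = (\<lambda>x. a * (x \<bullet> x) + w \<bullet> x + c * D k (x \<bullet> e) + b)"])
  show "\<exists>a w c k b'. (\<lambda>x. x \<bullet> x + D 0 (x \<bullet> e) + b) =
      (\<lambda>x. a * (x \<bullet> x) + w \<bullet> x + c * D k (x \<bullet> e) + b')"
    by (rule exI[of _ 1], rule exI[of _ 0], rule exI[of _ 1], rule exI[of _ 0], rule exI[of _ b])
      simp
next
  fix f :: "'a \<Rightarrow> real"
  assume "\<exists>a w c k b. f = (\<lambda>x. a * (x \<bullet> x) + w \<bullet> x + c * D k (x \<bullet> e) + b)"
  then obtain a w c k b where f: "f = (\<lambda>x. a * (x \<bullet> x) + w \<bullet> x + c * D k (x \<bullet> e) + b)"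
    by blast
  define f' where "f' x v = (2 * a) * (x \<bullet> v) + w \<bullet> v + c * (D (Suc k) (x \<bullet> e) * (v \<bullet> e))" for x v
  have "(f has_derivative f' x) (at x)" for x
    unfolding f f'_def
    by (auto intro!: derivative_eq_intros has_derivative_ridge[OF D]
        simp: inner_commute algebra_simps)
  moreover have "\<exists>a w c k b. (\<lambda>x. f' x v) = (\<lambda>x. a * (x \<bullet> x) + w \<bullet> x + c * D k (x \<bullet> e) + b)" for v
    by (rule exI[of _ 0], rule exI[of _ "(2 * a) *\<^sub>R v"], rule exI[of _ "c * (v \<bullet> e)"],
        rule exI[of _ "Suc k"], rule exI[of _ "w \<bullet> v"])
      (simp add: f'_def fun_eq_iff inner_commute)
  ultimately show "\<exists>f'. (\<forall>x. (f has_derivative f' x) (at x)) \<and>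
      (\<forall>v. \<exists>a w c k b. (\<lambda>x. f' x v) = (\<lambda>x. a * (x \<bullet> x) + w \<bullet> x + c * D k (x \<bullet> e) + b))"
    by blast
qed

text \<open>For \<open>m = 0\<close> this is the standard function \<open>exp (- 1 / u)\<close> that is flat at \<open>0\<close>. The powers of
  \<open>1 / u\<close> are the factors that differentiation produces.\<close>

definition flat :: "nat \<Rightarrow> real \<Rightarrow> real" where
  "flat m u = (if u > 0 then inverse u ^ m / exp (inverse u) else 0)"

lemma flat_Suc: "flat m u = u * flat (Suc m) u"
  by (simp add: flat_def)

lemma flat_tendsto_0: "(flat m \<longlongrightarrow> 0) (at 0)"
proof -
  have "((\<lambda>u. inverse u ^ m / exp (inverse u)) \<longlongrightarrow> (0::real)) (at_right 0)"
    using filterlim_compose[OF tendsto_power_div_exp_0 filterlim_inverse_at_top_right] .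
  moreover have "eventually (\<lambda>u. inverse u ^ m / exp (inverse u) = flat m u) (at_right 0)"
    by (auto simp: eventually_at_filter flat_def)
  ultimately have "(flat m \<longlongrightarrow> 0) (at_right 0)"
    by (rule Lim_transform_eventually)
  moreover have "eventually (\<lambda>u. 0 = flat m u) (at_left 0)"
    by (auto simp: eventually_at_filter flat_def)
  then have "(flat m \<longlongrightarrow> 0) (at_left 0)"
    by (rule Lim_transform_eventually[OF tendsto_const])
  ultimately show ?thesis by (simp add: filterlim_split_at_real)
qed

text \<open>Writing the derivative with the single function \<open>flat (m + 2)\<close>, rather than as a combination of
  \<open>flat (m + 1)\<close> and \<open>flat (m + 2)\<close>, keeps the class of functions used for bumps closed under
  differentiation. At \<open>0\<close> the difference quotient of \<open>flat m\<close> is \<open>flat (Suc m)\<close>, which tends to \<open>0\<close>.\<close>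

lemma flat_has_derivative:
  "(flat m has_real_derivative (1 - real m * u) * flat (m + 2) u) (at u)"
proof -
  consider "u > 0" | "u < 0" | "u = 0" by linarith
  then show ?thesis
  proof cases
    case 1
    have "real m * inverse u ^ (m - 1) * inverse u = real m * inverse u ^ m"
      by (cases m) auto
    then have "((\<lambda>u. inverse u ^ m / exp (inverse u)) has_real_derivative
        (1 - real m * u) * flat (m + 2) u) (at u)"
      using 1
      by (auto intro!: derivative_eq_intros simp: flat_def field_simps power2_eq_square)
    then show ?thesis
      by (rule DERIV_cong_ev[THEN iffD1, rotated -1])
        (use 1 in \<open>auto simp: flat_def eventually_nhds intro!: exI[of _ "{0<..}"]\<close>)
  next
    case 2
    have "((\<lambda>u. 0) has_real_derivative 0) (at u)" by simp
    then show ?thesis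
      by (rule DERIV_cong_ev[THEN iffD1, rotated -1])
        (use 2 in \<open>auto simp: flat_def eventually_nhds intro!: exI[of _ "{..<0}"]\<close>)
  next
    case 3
    have "(flat m (0 + h) - flat m 0) / h = flat (Suc m) h" for h
      by (simp add: flat_def divide_inverse mult_ac)
    then have "(flat m has_real_derivative 0) (at 0)"
      using flat_tendsto_0[of "Suc m"] by (simp add: DERIV_def)
    then show ?thesis using 3 by (simp add: flat_def)
  qed
qed

lemma derivative_tower_exists:
  assumes "\<And>g. P g \<Longrightarrow> \<exists>g'. P g' \<and> (\<forall>t. (g has_real_derivative g' t) (at t))" and "P f"
  obtains D where "derivative_tower D" "D 0 = f" "\<And>k. P (D k)"
proof -
  have "\<exists>D. \<forall>k. (P (D k) \<and> (k = 0 \<longrightarrow> D k = f)) \<and>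
      (\<forall>t. (D k has_real_derivative D (Suc k) t) (at t))"
    using assms by (intro dependent_nat_choice) auto
  then show ?thesis using that by (metis derivative_tower_def)
qed

lemma derivative_tower_add:
  "derivative_tower D \<Longrightarrow> derivative_tower E \<Longrightarrow> derivative_tower (\<lambda>k t. D k t + E k t)"
  by (simp add: derivative_tower_def DERIV_add)

lemma derivative_tower_scale:
  "derivative_tower D \<Longrightarrow> derivative_tower (\<lambda>k t. c * D k t)"
  by (simp add: derivative_tower_def DERIV_cmult)

lemma derivative_tower_reflect:
  assumes "derivative_tower D"
  shows "derivative_tower (\<lambda>k t. (- 1) ^ k * D k (- t))"
  unfolding derivative_tower_def
proof (intro allI)
  fix k t
  have "((\<lambda>t. D k (- t)) has_real_derivative D (Suc k) (- t) * (- 1)) (at t)"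
    using assms by (intro DERIV_chain2[of "D k"] derivative_towerD) (auto intro!: derivative_eq_intros)
  from DERIV_cmult[OF this, of "(- 1) ^ k"]
  show "((\<lambda>t. (- 1) ^ k * D k (- t)) has_real_derivative (- 1) ^ Suc k * D (Suc k) (- t)) (at t)"
    by simp
qed

text \<open>The bump is \<open>flat 0\<close> composed with the quadratic that is positive exactly between \<open>a\<close> and \<open>b\<close>. All
  its derivatives are of the form \<open>poly p t * flat m (poly q t)\<close>, so they are continuous and vanish off
  \<open>{a..b}\<close>; hence the second one is bounded, and scaling makes the bound as small as desired.\<close>

lemma bump_tower_exists:
  fixes a b \<eta> :: real
  assumes "a < b" "\<eta> > 0"
  obtains D where "derivative_tower D" "\<And>t. D 0 t \<ge> 0" "\<And>t. D 0 t > 0 \<longleftrightarrow> a < t \<and> t < b"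
    "\<And>t. \<bar>D 2 t\<bar> \<le> \<eta>"
proof -
  define q where "q = [:- (a * b), a + b, - 1:]"
  have q: "poly q t = (t - a) * (b - t)" for t
    by (simp add: q_def algebra_simps)
  define P where "P g \<longleftrightarrow> (\<exists>p m. g = (\<lambda>t. poly p t * flat m (poly q t)))" for g
  have "P (\<lambda>t. flat 0 (poly q t))"
    unfolding P_def by (rule exI[of _ 1]) auto
  moreover have "\<exists>g'. P g' \<and> (\<forall>t. (g has_real_derivative g' t) (at t))" if "P g" for g
  proof -
    from that obtain p m where g: "g = (\<lambda>t. poly p t * flat m (poly q t))"
      by (auto simp: P_def)
    define r where "r = pderiv p * q ^ 2 + p * pderiv q * (1 - of_nat m * q)"
    have "(g has_real_derivative poly r t * flat (m + 2) (poly q t)) (at t)" for t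
    proof -
      have "flat m u = u ^ 2 * flat (m + 2) u" for u
        using flat_Suc[of m u] flat_Suc[of "Suc m" u] by (simp add: power2_eq_square)
      then have "poly r t * flat (m + 2) (poly q t) = poly (pderiv p) t * flat m (poly q t) +
          (1 - real m * poly q t) * flat (m + 2) (poly q t) * poly (pderiv q) t * poly p t"
        by (simp add: r_def algebra_simps)
      moreover have "((\<lambda>t. flat m (poly q t)) has_real_derivative
          (1 - real m * poly q t) * flat (m + 2) (poly q t) * poly (pderiv q) t) (at t)"
        by (rule DERIV_chain2[OF flat_has_derivative poly_DERIV])
      ultimately show ?thesis
        unfolding g using DERIV_mult[OF poly_DERIV[of p t]] by simp
    qed
    moreover have "P (\<lambda>t. poly r t * flat (m + 2) (poly q t))"
      unfolding P_def by blast
    ultimately show ?thesis by blast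
  qed
  ultimately obtain D where D: "derivative_tower D" "D 0 = (\<lambda>t. flat 0 (poly q t))"
      "\<And>k. P (D k)"
    using derivative_tower_exists[of P "\<lambda>t. flat 0 (poly q t)"] by metis
  have "continuous_on {a..b} (D 2)"
    using derivative_towerD[OF D(1)] by (blast intro: continuous_at_imp_continuous_on DERIV_isCont)
  then have "bounded (D 2 ` {a..b})"
    by (intro compact_imp_bounded compact_continuous_image) auto
  then obtain M where M: "M > 0" "\<And>t. t \<in> {a..b} \<Longrightarrow> \<bar>D 2 t\<bar> \<le> M"
    by (auto simp: bounded_pos)
  have "D 2 t = 0" if "t \<notin> {a..b}" for t
  proof -
    have "poly q t \<le> 0"
      using that assms(1) unfolding q by (auto simp: not_le mult_le_0_iff)
    then show ?thesis using D(3)[of 2] by (auto simp: P_def flat_def)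
  qed
  with M have le: "\<bar>D 2 t\<bar> \<le> M" for t
    by (cases "t \<in> {a..b}") auto
  define E where "E k t = \<eta> / M * D k t" for k t
  show ?thesis
  proof
    show "derivative_tower E" unfolding E_def[abs_def] by (rule derivative_tower_scale[OF D(1)])
    show "E 0 t \<ge> 0" for t using M(1) assms(2) by (simp add: E_def D(2) flat_def)
    show "E 0 t > 0 \<longleftrightarrow> a < t \<and> t < b" for t
      using M(1) assms by (auto simp: E_def D(2) flat_def q zero_less_mult_iff)
    show "\<bar>E 2 t\<bar> \<le> \<eta>" for t
      using le[of t] M(1) assms(2) by (simp add: E_def abs_mult field_simps)
  qed
qed

section \<open>Dented balls\<close>

text \<open>Every matrix on the segment from the identity to \<open>M\<close> is positive definite, hence invertible, and
  the determinant cannot change sign along it.\<close>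

lemma det_pos_of_positive_definite:
  fixes M :: "real ^ 'n ^ 'n"
  assumes pos: "\<And>v. v \<noteq> 0 \<Longrightarrow> (M *v v) \<bullet> v > 0"
  shows "det M > 0"
proof (rule ccontr)
  define P where "P t = (1 - t) *\<^sub>R mat 1 + t *\<^sub>R M" for t :: real
  assume "\<not> det M > 0"
  moreover have "continuous_on {0..1} (\<lambda>t. det (P t))"
    unfolding det_def P_def by (intro continuous_intros)
  ultimately obtain t where t: "0 \<le> t" "t \<le> 1" "det (P t) = 0"
    using IVT2'[of "\<lambda>t. det (P t)" 1 0 0] by (force simp: P_def)
  obtain v where v: "v \<noteq> 0" "P t *v v = 0"
    using t(3) invertible_det_nz[of "P t"] by (auto simp: invertible_left_inverse matrix_left_invertible_ker)
  have "(1 - t) * (v \<bullet> v) + t * ((M *v v) \<bullet> v) = (P t *v v) \<bullet> v"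
    by (simp add: P_def matrix_vector_mult_add_rdistrib scaleR_matrix_vector_assoc[symmetric]
        inner_add_left)
  moreover have "v \<bullet> v > 0" "(M *v v) \<bullet> v > 0" using v pos by auto
  ultimately show False
    using t(1,2) v(2)
    by (cases "t = 1") (auto simp: add_pos_nonneg order.strict_iff_order add_nonneg_eq_0_iff)
qed

text \<open>For \<open>\<phi> \<ge> 0\<close> this is the unit ball with a dent, rotationally symmetric about the axis \<open>e\<close>, at the
  heights \<open>x \<bullet> e\<close> where \<open>\<phi>\<close> is positive.\<close>

definition dented_ball :: "'a::euclidean_space \<Rightarrow> (real \<Rightarrow> real) \<Rightarrow> 'a set" where
  "dented_ball e \<phi> = {x. x \<bullet> x + \<phi> (x \<bullet> e) \<le> 1}"

text \<open>The bound on the second derivative makes the dent shallow enough for convexity: the ball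
  contributes \<open>2\<close> to the Hessian of \<open>x \<bullet> x + D 0 (x \<bullet> e)\<close>, so at least \<open>1\<close> is left.\<close>

locale dent_profile =
  fixes e :: "'a::euclidean_space" and D :: "nat \<Rightarrow> real \<Rightarrow> real"
  assumes norm_e [simp]: "e \<bullet> e = 1"
    and tower: "derivative_tower D"
    and nonneg: "\<And>t. D 0 t \<ge> 0"
    and at_0 [simp]: "D 0 0 = 0"
    and D2: "\<And>t. \<bar>D 2 t\<bar> \<le> 1"
begin

text \<open>The boundary is a level set of \<open>F\<close>, whose gradient is \<open>G\<close> and whose Hessian at \<open>x\<close> is \<open>dG x\<close>.\<close>

definition F :: "'a \<Rightarrow> real" where "F x = x \<bullet> x + D 0 (x \<bullet> e)"
definition G :: "'a \<Rightarrow> 'a" where "G x = 2 *\<^sub>R x + D 1 (x \<bullet> e) *\<^sub>R e"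
definition dG :: "'a \<Rightarrow> 'a \<Rightarrow> 'a" where "dG x v = 2 *\<^sub>R v + (D 2 (x \<bullet> e) * (v \<bullet> e)) *\<^sub>R e"

abbreviation K :: "'a set" where "K \<equiv> dented_ball e (D 0)"

lemma K_eq: "K = {x. F x \<le> 1}"
  by (simp add: dented_ball_def F_def)

lemma inner_e_le: "(x \<bullet> e)\<^sup>2 \<le> x \<bullet> x"
  using Cauchy_Schwarz_ineq[of x e] by simp

lemma has_derivative_F: "(F has_derivative (\<lambda>v. G x \<bullet> v)) (at x)"
  unfolding F_def G_def
  by (auto intro!: derivative_eq_intros has_derivative_ridge[OF tower]
      simp: inner_commute algebra_simps inner_add)

lemma has_derivative_G: "(G has_derivative dG x) (at x)"
  unfolding G_def dG_def
  by (auto intro!: derivative_eq_intros has_derivative_ridge[OF tower] simp: numeral_2_eq_2)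

lemma dG_inner_ge: "dG x v \<bullet> v \<ge> v \<bullet> v"
proof -
  have "- ((v \<bullet> e)\<^sup>2) \<le> D 2 (x \<bullet> e) * (v \<bullet> e)\<^sup>2"
    using mult_right_mono[of "- 1" "D 2 (x \<bullet> e)" "(v \<bullet> e)\<^sup>2"] D2[of "x \<bullet> e"] by (simp add: abs_le_iff)
  then show ?thesis
    using inner_e_le[of v] by (simp add: dG_def inner_add power2_eq_square inner_commute)
qed

text \<open>This quantitative convexity serves three purposes: convexity of the body, nonvanishing of the
  gradient on the level set, and the fact that the gradient is an outer normal.\<close>

lemma F_strongly_convex: "F y \<ge> F x + G x \<bullet> (y - x) + (y - x) \<bullet> (y - x) / 2"
proof -
  define t s where "t = x \<bullet> e" and "s = y \<bullet> e"
  \<comment> \<open>The quadratic part of the ball compensates the possible concavity of the profile.\<close>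
  have "D 0 s \<ge> D 0 t + D 1 t * (s - t) - (s - t)\<^sup>2 / 2"
  proof -
    define h where "h r = D 0 r + r\<^sup>2 / 2" for r
    have "convex_on UNIV h"
    proof (rule f''_ge0_imp_convex)
      show "(h has_real_derivative D 1 r + r) (at r)" for r
        unfolding h_def using derivative_towerD[OF tower, of 0]
        by (auto intro!: derivative_eq_intros)
      show "((\<lambda>r. D 1 r + r) has_real_derivative D 2 r + 1) (at r)" for r
        using derivative_towerD[OF tower, of 1]
        by (auto intro!: derivative_eq_intros simp: numeral_2_eq_2)
      show "0 \<le> D 2 r + 1" for r using D2[of r] by (simp add: abs_le_iff)
    qed auto
    moreover have "(h has_real_derivative D 1 t + t) (at t)"
      unfolding h_def using derivative_towerD[OF tower, of 0]
      by (auto intro!: derivative_eq_intros)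
    ultimately have "h s - h t \<ge> (D 1 t + t) * (s - t)"
      by (intro convex_on_imp_above_tangent[of UNIV]) auto
    then show ?thesis
      by (simp add: h_def power2_eq_square field_simps)
  qed
  moreover have "(s - t)\<^sup>2 \<le> (y - x) \<bullet> (y - x)"
    using inner_e_le[of "y - x"] by (simp add: s_def t_def inner_diff_left)
  moreover have "y \<bullet> y = x \<bullet> x + 2 * (x \<bullet> (y - x)) + (y - x) \<bullet> (y - x)"
    by (simp add: inner_diff inner_commute)
  moreover have "G x \<bullet> (y - x) = 2 * (x \<bullet> (y - x)) + D 1 t * (s - t)"
    unfolding G_def s_def t_def
    by (simp add: inner_add_left inner_diff_left inner_commute[of e] flip: inner_diff_right)
  ultimately show ?thesis
    unfolding F_def s_def[symmetric] t_def[symmetric] by linarith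
qed

lemma continuous_F: "continuous_on S F"
  using has_derivative_F by (blast intro: continuous_at_imp_continuous_on has_derivative_continuous)

lemma K_subset_ball: "K \<subseteq> cball 0 1"
proof
  fix x assume "x \<in> K"
  then have "x \<bullet> x \<le> 1" using nonneg[of "x \<bullet> e"] by (simp add: dented_ball_def)
  then show "x \<in> cball 0 1" by (simp add: norm_le_square)
qed

lemma closed_K: "closed K"
  unfolding K_eq using continuous_F by (intro closed_Collect_le) auto

lemma convex_K: "convex K"
  unfolding K_eq
proof (rule convexI)
  fix x y :: 'a and u v :: real
  assume xy: "x \<in> {x. F x \<le> 1}" "y \<in> {x. F x \<le> 1}" and uv: "0 \<le> u" "0 \<le> v" "u + v = 1"
  define z where "z = u *\<^sub>R x + v *\<^sub>R y"
  have "F z + G z \<bullet> (w - z) \<le> F w" for w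
    using F_strongly_convex[of z w] inner_ge_zero[of "w - z"] by linarith
  then have "u * (F z + G z \<bullet> (x - z)) + v * (F z + G z \<bullet> (y - z)) \<le> u * F x + v * F y"
    using uv by (intro add_mono mult_left_mono) auto
  also have "\<dots> \<le> u * 1 + v * 1"
    using xy uv by (intro add_mono mult_left_mono) auto
  also have "u * (F z + G z \<bullet> (x - z)) + v * (F z + G z \<bullet> (y - z)) =
      (u + v) * F z + G z \<bullet> (u *\<^sub>R x + v *\<^sub>R y - (u + v) *\<^sub>R z)"
    by (simp add: algebra_simps inner_diff inner_add)
  finally show "u *\<^sub>R x + v *\<^sub>R y \<in> {x. F x \<le> 1}"
    using uv by (simp add: z_def)
qed

lemma open_sublevel: "open {x. F x < 1}"
  using continuous_F by (intro open_Collect_less) auto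

lemma convex_body_K: "convex_body K"
proof -
  have "{x. F x < 1} \<subseteq> interior K"
    using open_sublevel by (intro interior_maximal) (auto simp: K_eq)
  moreover have "F 0 < 1" by (simp add: F_def)
  moreover have "bounded K" using K_subset_ball bounded_cball bounded_subset by blast
  ultimately show ?thesis
    using closed_K convex_K by (auto simp: convex_body_def compact_eq_bounded_closed)
qed

lemma G_nonzero:
  assumes "F x = 1"
  shows "G x \<noteq> 0"
proof
  assume "G x = 0"
  moreover have "F 0 = 0" by (simp add: F_def)
  ultimately show False
    using F_strongly_convex[where x = x and y = 0] assms inner_ge_zero[of x] by simp
qed

lemma frontier_K: "frontier K = {x. F x = 1}"
proof -
  have "interior K = {x. F x < 1}"
  proof (intro equalityI subsetI)
    fix x assume "x \<in> interior K"
    then obtain r where r: "r > 0" "cball x r \<subseteq> K" by (meson mem_interior_cball)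
    then have "F x \<le> 1" using interior_subset \<open>x \<in> interior K\<close> by (auto simp: K_eq)
    moreover have False if "F x = 1"
    proof -
      \<comment> \<open>Moving a little in the direction of the gradient leaves the body.\<close>
      define y where "y = x + (r / norm (G x)) *\<^sub>R G x"
      have "y \<in> cball x r" using r G_nonzero[OF that] by (simp add: y_def dist_norm)
      then have "F y \<le> 1" using r by (auto simp: K_eq)
      moreover have "G x \<bullet> (y - x) > 0" using r G_nonzero[OF that] by (simp add: y_def)
      ultimately show False
        using F_strongly_convex[of x y] that inner_ge_zero[of "y - x"] by linarith
    qed
    ultimately show "x \<in> {x. F x < 1}" by force
  next
    fix x assume "x \<in> {x. F x < 1}"
    then show "x \<in> interior K"
      using open_sublevel by (auto simp: K_eq interior_def)
  qed
  then show ?thesis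
    using closed_K by (auto simp: frontier_def K_eq)
qed

lemma smooth_hypersurface_frontier: "smooth_hypersurface (frontier K)"
  unfolding smooth_hypersurface_def
proof (intro ballI exI conjI)
  show "smooth_on (\<lambda>x. x \<bullet> x + D 0 (x \<bullet> e) + (- 1)) UNIV"
    by (rule smooth_on_norm2_plus_ridge[OF tower])
  show "frontier K \<inter> UNIV = {x \<in> UNIV. x \<bullet> x + D 0 (x \<bullet> e) + (- 1) = 0}"
    by (auto simp: frontier_K F_def)
  fix x assume "x \<in> frontier K \<inter> UNIV"
  then have "G x \<noteq> 0" by (simp add: frontier_K G_nonzero)
  have "((\<lambda>x. F x + (- 1)) has_derivative (\<lambda>v. G x \<bullet> v)) (at x)"
    using has_derivative_F by (auto intro!: derivative_eq_intros)
  then have "frechet_derivative (\<lambda>x. F x + (- 1)) (at x) = (\<lambda>v. G x \<bullet> v)"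
    by (metis frechet_derivative_at)
  then show "frechet_derivative (\<lambda>x. x \<bullet> x + D 0 (x \<bullet> e) + (- 1)) (at x) (G x) \<noteq> 0"
    using \<open>G x \<noteq> 0\<close> by (simp add: F_def)
qed auto

definition \<nu> :: "'a \<Rightarrow> 'a" where "\<nu> x = inverse (norm (G x)) *\<^sub>R G x"

text \<open>The differential of the Gauss map is the Hessian divided by the length of the gradient, with
  the normal component removed.\<close>

definition W :: "'a \<Rightarrow> 'a \<Rightarrow> 'a" where
  "W x v = inverse (norm (G x)) *\<^sub>R (dG x v - (\<nu> x \<bullet> dG x v) *\<^sub>R \<nu> x)"

lemma gauss_map_\<nu>: "gauss_map K \<nu>"
  unfolding gauss_map_def
proof (intro ballI conjI)
  fix x assume "x \<in> frontier K"
  then have x: "F x = 1" "G x \<noteq> 0" by (auto simp: frontier_K G_nonzero)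
  then show "norm (\<nu> x) = 1" by (simp add: \<nu>_def)
  fix y assume "y \<in> K"
  then have "G x \<bullet> (y - x) \<le> 0"
    using F_strongly_convex[of x y] x inner_ge_zero[of "y - x"] unfolding K_eq mem_Collect_eq
    by linarith
  then show "\<nu> x \<bullet> (y - x) \<le> 0" by (simp add: \<nu>_def mult_nonneg_nonpos)
qed

lemma has_derivative_\<nu>:
  assumes "G x \<noteq> 0"
  shows "(\<nu> has_derivative W x) (at x)"
proof -
  have *: "((\<lambda>x. norm (G x)) has_derivative (\<lambda>v. dG x v \<bullet> sgn (G x))) (at x)"
    using has_derivative_compose[OF has_derivative_G has_derivative_norm[OF assms]] by simp
  have "norm (G x) \<noteq> 0" using assms by simp
  from has_derivative_scaleR[OF Deriv.has_derivative_inverse[OF this *] has_derivative_G]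
  show ?thesis
    unfolding \<nu>_def[abs_def] W_def[abs_def]
    by (rule has_derivative_eq_rhs)
      (simp add: fun_eq_iff sgn_div_norm inner_commute algebra_simps)
qed

lemma norm_\<nu>: "G x \<noteq> 0 \<Longrightarrow> \<nu> x \<bullet> \<nu> x = 1"
  by (simp add: \<nu>_def flip: power2_norm_eq_inner)

text \<open>On the tangent space the quadratic form of \<open>W x\<close> is that of the Hessian divided by the length of the
  gradient, so it is positive; the normal direction contributes \<open>(v \<bullet> n)\<^sup>2\<close>, without mixed terms.\<close>

lemma weingarten_positive:
  assumes "G x \<noteq> 0" and "v \<noteq> 0"
  defines "n \<equiv> \<nu> x"
  shows "(W x (v - (v \<bullet> n) *\<^sub>R n) + (v \<bullet> n) *\<^sub>R n) \<bullet> v > 0"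
proof -
  define u where "u = v - (v \<bullet> n) *\<^sub>R n"
  have nn: "n \<bullet> n = 1" using norm_\<nu>[OF assms(1)] by (simp add: n_def)
  then have un: "u \<bullet> n = 0" by (simp add: u_def inner_diff_left)
  have v: "v = u + (v \<bullet> n) *\<^sub>R n" by (simp add: u_def)
  have Wn: "W x u \<bullet> n = 0"
    using nn inner_commute[of n "dG x u"] by (simp add: W_def n_def[symmetric] inner_diff_left)
  have Wu: "W x u \<bullet> u = inverse (norm (G x)) * (dG x u \<bullet> u)"
    using un inner_commute[of n u] by (simp add: W_def n_def[symmetric] inner_diff_left)
  have "W x u \<bullet> v = W x u \<bullet> u"
    using arg_cong[OF v, of "\<lambda>z. W x u \<bullet> z"] Wn by (simp add: inner_add_right)
  then have "(W x u + (v \<bullet> n) *\<^sub>R n) \<bullet> v = W x u \<bullet> u + (v \<bullet> n)\<^sup>2"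
    using inner_commute[of n v] by (simp add: inner_add_left power2_eq_square)
  also have "\<dots> \<ge> inverse (norm (G x)) * (u \<bullet> u) + (v \<bullet> n)\<^sup>2"
    unfolding Wu using dG_inner_ge by (intro add_right_mono mult_left_mono) auto
  finally have *: "(W x u + (v \<bullet> n) *\<^sub>R n) \<bullet> v \<ge> inverse (norm (G x)) * (u \<bullet> u) + (v \<bullet> n)\<^sup>2" .
  have "inverse (norm (G x)) * (u \<bullet> u) + (v \<bullet> n)\<^sup>2 > 0"
  proof (cases "u = 0")
    case True
    then have "v \<bullet> n \<noteq> 0" using v assms(2) by auto
    then show ?thesis using True by simp
  next
    case False
    then have "inverse (norm (G x)) * (u \<bullet> u) > 0" using assms(1) by simp
    then show ?thesis using zero_le_power2[of "v \<bullet> n"] by linarith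
  qed
  with * show ?thesis by (simp add: u_def)
qed

text \<open>An isometry that fixes the axis pointwise preserves both the norm and the height above the
  hyperplane orthogonal to \<open>e\<close>, and these determine membership in the body.\<close>

lemma body_of_revolution_K: "body_of_revolution K"
  unfolding body_of_revolution_def
proof (intro conjI convex_body_K exI allI impI)
  show "e \<noteq> 0" using norm_e by (metis inner_zero_left zero_neq_one)
  fix T assume "isometry T \<and> (\<forall>t. T (0 + t *\<^sub>R e) = 0 + t *\<^sub>R e)"
  then have T: "isometry T" and fix_axis: "\<And>t. T (t *\<^sub>R e) = t *\<^sub>R e" by auto
  from fix_axis[of 0] have "T 0 = 0" by simp
  then have orth: "orthogonal_transformation T"
    using T by (simp add: orthogonal_transformation_isometry isometry_def)
  have inner: "T x \<bullet> T y = x \<bullet> y" for x y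
    using orth by (simp add: orthogonal_transformation_def)
  have "T e = e" using fix_axis[of 1] by simp
  have "T x \<bullet> e = x \<bullet> e" for x
    using inner[of x e] unfolding \<open>T e = e\<close> .
  then have mem: "T x \<in> K \<longleftrightarrow> x \<in> K" for x by (simp add: dented_ball_def inner)
  show "T ` K = K"
  proof (intro equalityI subsetI)
    fix x assume "x \<in> K"
    moreover obtain y where "x = T y"
      using orthogonal_transformation_surj[OF orth] by (metis surjD)
    ultimately show "x \<in> T ` K" using mem by blast
  qed (use mem in blast)
qed

end

lemma C_infinity_plus_dented_ball:
  fixes e :: "real ^ 'n"
  assumes "dent_profile e D"
  shows "C_infinity_plus (dented_ball e (D 0))"
proof -
  interpret dent_profile e D by fact
  show ?thesis
    unfolding C_infinity_plus_def
  proof (intro conjI convex_body_K smooth_hypersurface_frontier ballI)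
    fix p assume "p \<in> frontier K"
    then have Gp: "G p \<noteq> 0" by (simp add: frontier_K G_nonzero)
    define M where "M v = W p (v - (v \<bullet> \<nu> p) *\<^sub>R \<nu> p) + (v \<bullet> \<nu> p) *\<^sub>R \<nu> p" for v
    have lin: "linear (W p)"
      using has_derivative_\<nu>[OF Gp] by (rule has_derivative_linear)
    have "linear M"
      unfolding M_def
      by (rule linearI)
        (simp_all add: linear_diff[OF lin] linear_add[OF lin] linear_cmul[OF lin]
          algebra_simps inner_add_left)
    then have "(matrix M *v v) \<bullet> v > 0" if "v \<noteq> 0" for v
      using weingarten_positive[OF Gp that] by (simp add: matrix_works M_def)
    then have "det (matrix M) > 0" by (rule det_pos_of_positive_definite)
    moreover have "has_gaussian_curvature K p (det (matrix M))"
      unfolding has_gaussian_curvature_def M_def[abs_def]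
      using gauss_map_\<nu> has_derivative_at_withinI[OF has_derivative_\<nu>[OF Gp]] by blast
    ultimately show "\<exists>c>0. has_gaussian_curvature K p c" by blast
  qed
qed

lemma dented_ball_Int:
  assumes "\<And>t. \<phi> t \<ge> 0" "\<And>t. \<psi> t \<ge> 0" "\<And>t. \<phi> t = 0 \<or> \<psi> t = 0"
  shows "dented_ball e \<phi> \<inter> dented_ball e \<psi> = dented_ball e (\<lambda>t. \<phi> t + \<psi> t)"
proof (intro set_eqI)
  fix x
  show "x \<in> dented_ball e \<phi> \<inter> dented_ball e \<psi> \<longleftrightarrow> x \<in> dented_ball e (\<lambda>t. \<phi> t + \<psi> t)"
    using assms(1)[of "x \<bullet> e"] assms(2)[of "x \<bullet> e"] assms(3)[of "x \<bullet> e"]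
    by (auto simp: dented_ball_def)
qed

lemma dented_ball_Un:
  fixes e :: "'a::euclidean_space"
  assumes "\<And>t. \<phi> t \<ge> 0" "\<And>t. \<psi> t \<ge> 0" "\<And>t. \<phi> t = 0 \<or> \<psi> t = 0"
  shows "dented_ball e \<phi> \<union> dented_ball e \<psi> = cball 0 1"
proof (intro set_eqI)
  fix x :: 'a
  have "x \<in> cball 0 1 \<longleftrightarrow> x \<bullet> x \<le> 1" by (simp add: norm_le_square)
  then show "x \<in> dented_ball e \<phi> \<union> dented_ball e \<psi> \<longleftrightarrow> x \<in> cball 0 1"
    using assms(1)[of "x \<bullet> e"] assms(2)[of "x \<bullet> e"] assms(3)[of "x \<bullet> e"]
    by (auto simp: dented_ball_def)
qed

lemma uminus_dented_ball:
  "uminus ` dented_ball e \<phi> = dented_ball e (\<lambda>t. \<phi> (- t))"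
proof (intro equalityI subsetI)
  fix x assume "x \<in> dented_ball e (\<lambda>t. \<phi> (- t))"
  then have "- x \<in> dented_ball e \<phi>" by (simp add: dented_ball_def)
  then show "x \<in> uminus ` dented_ball e \<phi>" by (metis image_eqI minus_minus)
qed (auto simp: dented_ball_def)

section \<open>The smooth bodies of revolution\<close>

text \<open>Points at height at least \<open>4/5\<close> have horizontal part of length at most \<open>3/5\<close>, so the product of the
  heights outweighs the inner product of the horizontal parts.\<close>

lemma inner_pos_in_cap:
  fixes e x y :: "'a::euclidean_space"
  assumes "e \<bullet> e = 1" "x \<bullet> x \<le> 1" "y \<bullet> y \<le> 1" "x \<bullet> e \<ge> 4/5" "y \<bullet> e \<ge> 4/5"
  shows "x \<bullet> y \<ge> 0"
proof -
  define x' y' where "x' = x - (x \<bullet> e) *\<^sub>R e" and "y' = y - (y \<bullet> e) *\<^sub>R e"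
  have sq: "(16::real)/25 \<le> (z \<bullet> e)\<^sup>2" if "z \<bullet> e \<ge> 4/5" for z :: 'a
    using power_mono[OF that, of 2] by (simp add: power2_eq_square)
  have "x' \<bullet> x' = x \<bullet> x - (x \<bullet> e)\<^sup>2" "y' \<bullet> y' = y \<bullet> y - (y \<bullet> e)\<^sup>2"
    using assms(1) by (simp_all add: x'_def y'_def inner_diff inner_commute power2_eq_square)
  then have "x' \<bullet> x' \<le> 9/25" "y' \<bullet> y' \<le> 9/25"
    using assms(2,3) sq[OF assms(4)] sq[OF assms(5)] by linarith+
  moreover have "0 \<le> (x' + y') \<bullet> (x' + y')" by simp
  then have "- 2 * (x' \<bullet> y') \<le> x' \<bullet> x' + y' \<bullet> y'" by (simp add: inner_add inner_commute)
  moreover have "(4/5) * (4/5) \<le> (x \<bullet> e) * (y \<bullet> e)"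
    using assms(4,5) by (intro mult_mono) auto
  moreover have "x \<bullet> y = x' \<bullet> y' + (x \<bullet> e) * (y \<bullet> e)"
    using assms(1) by (simp add: x'_def y'_def inner_diff inner_commute)
  ultimately show ?thesis by linarith
qed

text \<open>Both bodies have a dent at the heights in \<open>(9/10, 1)\<close>. The second dent is at the heights in
  \<open>(4/5, 9/10)\<close> for \<open>K\<close> and in \<open>(- 9/10, - 4/5)\<close> for \<open>L\<close>. All points removed from \<open>K\<close> lie in the cap
  around \<open>e\<close>, where angles are acute, whereas \<open>L\<close> loses points near \<open>e\<close> and points near \<open>- e\<close>. The
  equatorial points \<open>u\<close> and \<open>- u\<close> survive and pin down the centre.\<close>

lemma exists_smooth_pair:
  fixes e u :: "real ^ 'n"
  assumes eu: "e \<bullet> e = 1" "u \<bullet> u = 1" "e \<bullet> u = 0"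
  shows "\<exists>K L :: (real ^ 'n) set. noncongruent_with_equal_sections K L \<and>
    C_infinity_plus K \<and> body_of_revolution K \<and> C_infinity_plus L \<and> body_of_revolution L"
proof -
  have ue: "u \<bullet> e = 0" using eu(3) by (simp add: inner_commute)
  obtain D where D: "derivative_tower D" "\<And>t. D 0 t \<ge> 0"
      "\<And>t. D 0 t > 0 \<longleftrightarrow> 9/10 < t \<and> t < (1::real)" "\<And>t. \<bar>D 2 t\<bar> \<le> 1/2"
    using bump_tower_exists[of "9/10" 1 "1/2"] by auto
  obtain E where E: "derivative_tower E" "\<And>t. E 0 t \<ge> 0"
      "\<And>t. E 0 t > 0 \<longleftrightarrow> 4/5 < t \<and> t < (9/10::real)" "\<And>t. \<bar>E 2 t\<bar> \<le> 1/2"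
    using bump_tower_exists[of "4/5" "9/10" "1/2"] by auto
  have zero_iff: "D 0 t = 0 \<longleftrightarrow> \<not> (9/10 < t \<and> t < 1)" "E 0 t = 0 \<longleftrightarrow> \<not> (4/5 < t \<and> t < 9/10)" for t
    using D(2,3)[of t] E(2,3)[of t] by linarith+
  then have zeroD: "\<not> (9/10 < t \<and> t < 1) \<Longrightarrow> D 0 t = 0"
    and zeroE: "\<not> (4/5 < t \<and> t < 9/10) \<Longrightarrow> E 0 t = 0" for t
    by blast+
  define A C where "A = dented_ball e (D 0)" and "C = dented_ball e (E 0)"
  define DK where "DK k t = D k t + E k t" for k t
  define DL where "DL k t = D k t + (- 1) ^ k * E k (- t)" for k t
  have AC: "A \<inter> C = dented_ball e (DK 0)" "A \<union> C = cball 0 1"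
    unfolding A_def C_def DK_def using D(2) E(2)
    by (intro dented_ball_Int dented_ball_Un; force simp: zero_iff)+
  have AC': "A \<inter> uminus ` C = dented_ball e (DL 0)" "A \<union> uminus ` C = cball 0 1"
    unfolding A_def C_def uminus_dented_ball DL_def power_0 mult_1_left using D(2) E(2)
    by (intro dented_ball_Int dented_ball_Un; force simp: zero_iff)+
  have profK: "dent_profile e DK"
  proof
    show "derivative_tower DK"
      unfolding DK_def[abs_def] by (intro derivative_tower_add D E)
    show "\<bar>DK 2 t\<bar> \<le> 1" for t
      using D(4)[of t] E(4)[of t] by (simp add: DK_def)
  qed (use eu D(2) E(2) in \<open>auto simp: DK_def zeroD zeroE\<close>)
  have profL: "dent_profile e DL"
  proof
    show "derivative_tower DL"
      unfolding DL_def[abs_def] by (intro derivative_tower_add derivative_tower_reflect D E)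
    show "\<bar>DL 2 t\<bar> \<le> 1" for t
      using D(4)[of t] E(4)[of "- t"] by (simp add: DL_def)
  qed (use eu D(2) E(2) in \<open>auto simp: DL_def zeroD zeroE\<close>)
  have profD: "dent_profile e D"
  proof
    show "\<bar>D 2 t\<bar> \<le> 1" for t using D(4)[of t] by simp
  qed (use eu D in \<open>auto simp: zeroD zeroE\<close>)
  have profE: "dent_profile e E"
  proof
    show "\<bar>E 2 t\<bar> \<le> 1" for t using E(4)[of t] by simp
  qed (use eu E in \<open>auto simp: zeroD zeroE\<close>)
  have "\<not> congruent_sets (A \<inter> C) (A \<inter> uminus ` C)"
  proof (rule not_congruent_if_opposite_cuts)
    show "u \<in> A \<inter> C" "- u \<in> A \<inter> C"
      unfolding AC using eu ue by (simp_all add: dented_ball_def DK_def zeroD zeroE)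
    have "norm u = 1" using eu by (simp add: norm_eq_1)
    then show "A \<inter> uminus ` C \<subseteq> cball 0 (norm u)"
      unfolding AC' using dent_profile.K_subset_ball[OF profL] by simp
  next
    have cap: "x \<bullet> x \<le> 1 \<and> x \<bullet> e \<ge> 4/5" if "x \<notin> A \<inter> C" "- x \<in> A \<inter> C" for x
    proof -
      have "- x \<in> cball 0 1" using that(2) AC(2) by blast
      then have "x \<bullet> x \<le> 1" by (simp add: norm_le_square)
      moreover from this that(1) have "DK 0 (x \<bullet> e) \<noteq> 0" by (auto simp: AC dented_ball_def)
      then have "x \<bullet> e \<ge> 4/5"
        using zero_iff[of "x \<bullet> e"] by (auto simp: DK_def)
      ultimately show ?thesis by simp
    qed
    fix x y assume "x \<notin> A \<inter> C" "- x \<in> A \<inter> C" "y \<notin> A \<inter> C" "- y \<in> A \<inter> C"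
    then show "x \<bullet> y \<ge> 0"
      using cap[of x] cap[of y] inner_pos_in_cap[OF eu(1), of x y] by blast
  next
    \<comment> \<open>Unit vectors at heights inside the two dents of the second body, with opposite horizontal parts.\<close>
    define x where "x = (19/20) *\<^sub>R e + sqrt (1 - (19/20)\<^sup>2) *\<^sub>R u"
    define y where "y = - (17/20) *\<^sub>R e - sqrt (1 - (17/20)\<^sup>2) *\<^sub>R u"
    have x: "x \<bullet> e = 19/20" "x \<bullet> x = 1" and y: "y \<bullet> e = - (17/20)" "y \<bullet> y = 1"
      using eu ue by (simp_all add: x_def y_def inner_add inner_diff
          flip: power2_eq_square) (simp_all add: power2_eq_square)
    have "DL 0 (19/20) > 0" "DL 0 (- (17/20)) > 0" "DL 0 (- (19/20)) = 0" "DL 0 (17/20) = 0"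
      using D(3)[of "19/20"] E(3)[of "17/20"] by (simp_all add: DL_def zeroD zeroE)
    then show "x \<notin> A \<inter> uminus ` C" "y \<notin> A \<inter> uminus ` C"
        "- x \<in> A \<inter> uminus ` C" "- y \<in> A \<inter> uminus ` C"
      unfolding AC' dented_ball_def mem_Collect_eq inner_minus_left inner_minus_right minus_minus x y
      by simp_all
    have "x \<bullet> y = - (19/20) * (17/20) - sqrt (1 - (19/20)\<^sup>2) * sqrt (1 - (17/20)\<^sup>2)"
      using eu ue by (simp add: x_def y_def inner_add inner_diff)
    moreover have "0 \<le> sqrt (1 - (19/20)\<^sup>2) * sqrt (1 - (17/20)\<^sup>2)"
      by (simp add: power2_eq_square)
    ultimately show "x \<bullet> y < 0" by linarith
  qed
  moreover have "compact A" "compact C"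
    using dent_profile.convex_body_K[OF profD] dent_profile.convex_body_K[OF profE]
    by (simp_all add: A_def C_def convex_body_def)
  moreover have "convex_body (A \<inter> C)" "convex_body (A \<inter> uminus ` C)"
    unfolding AC AC'
    using dent_profile.convex_body_K[OF profK] dent_profile.convex_body_K[OF profL] .
  ultimately have "noncongruent_with_equal_sections (A \<inter> C) (A \<inter> uminus ` C)"
    using AC AC' by (intro noncongruent_with_equal_sectionsI) simp_all
  then show ?thesis
    using C_infinity_plus_dented_ball[OF profK] C_infinity_plus_dented_ball[OF profL]
      dent_profile.body_of_revolution_K[OF profK] dent_profile.body_of_revolution_K[OF profL]
    unfolding AC AC' by blast
qed

section \<open>The polytopes\<close>

text \<open>In the plane of two coordinates \<open>i\<close> and \<open>j\<close>, the body \<open>B\<close> is the hexagon obtained from the square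
  \<open>[-1, 1]\<^sup>2\<close> by truncating it at \<open>(1, 1)\<close> and \<open>(-1, -1)\<close>. It is multiplied with a cube in the other
  coordinates, so small that these do not spoil the signs of inner products. The corners
  \<open>(1, -1)\<close> and \<open>(-1, 1)\<close> remain the farthest points and pin down the centre. The vertices \<open>(1, 1/2)\<close>
  and \<open>(1/2, 1)\<close>, which enclose an acute angle, are cut off for \<open>K\<close>; for \<open>L\<close> the second cut is made at
  the antipode \<open>(-1/2, -1)\<close> instead.\<close>

lemma exists_polytope_pair:
  assumes "CARD('n::finite) \<ge> 2"
  shows "\<exists>K L :: (real ^ 'n) set. noncongruent_with_equal_sections K L \<and> polytope K \<and> polytope L"
proof -
  obtain i j :: 'n where ij: "i \<noteq> j"
    using assms card_le_Suc0_iff_eq[of "UNIV :: 'n set"] by auto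
  define N where "N = real CARD('n)"
  have N: "N \<ge> 2" using assms by (simp add: N_def)
  define r :: "real ^ 'n" where "r = (\<chi> k. if k = i \<or> k = j then 1 else 1 / N)"
  have r_simps: "r $ i = 1" "r $ j = 1" "\<And>k. k \<noteq> i \<Longrightarrow> k \<noteq> j \<Longrightarrow> r $ k = 1 / N"
    by (auto simp: r_def)
  define d1 d2 where "d1 = 2 *\<^sub>R axis i 1 + (axis j 1 :: real ^ 'n)"
    and "d2 = axis i 1 + 2 *\<^sub>R (axis j 1 :: real ^ 'n)"
  have inner: "d1 \<bullet> x = 2 * x $ i + x $ j" "d2 \<bullet> x = x $ i + 2 * x $ j" for x
    by (simp_all add: d1_def d2_def inner_add inner_axis')
  define B where "B = cbox (- r) r \<inter> {x. (d1 + d2) \<bullet> x \<le> 9/2} \<inter> {x. (d1 + d2) \<bullet> x \<ge> - 9/2}"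
  have mem_B: "x \<in> B \<longleftrightarrow> (\<forall>k. \<bar>x $ k\<bar> \<le> r $ k) \<and> \<bar>x $ i + x $ j\<bar> \<le> 3/2" for x
  proof -
    have "(d1 + d2) \<bullet> x = 3 * (x $ i + x $ j)" by (simp add: inner inner_add_left)
    moreover have "x \<in> cbox (- r) r \<longleftrightarrow> (\<forall>k. \<bar>x $ k\<bar> \<le> r $ k)"
      by (simp add: mem_box_cart abs_le_iff minus_le_iff conj_commute)
    moreover have "\<bar>s\<bar> \<le> 3/2 \<longleftrightarrow> 3 * s \<le> 9/2 \<and> 3 * s \<ge> - 9/2" for s :: real
      by arith
    ultimately show ?thesis unfolding B_def Int_iff mem_Collect_eq by metis
  qed
  have uminus_B: "- x \<in> B" if "x \<in> B" for x
    using that abs_minus_cancel[of "x $ i + x $ j"] by (simp add: mem_B)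
  \<comment> \<open>The first functional is 5/2 at the vertex (1, 1/2) and at most 2 at the other vertices of the
    hexagon; 9/4 lies halfway between. The second functional is its mirror image.\<close>
  define A where "A = B \<inter> {x. d1 \<bullet> x \<le> 9/4}"
  define C where "C = B \<inter> {x. d2 \<bullet> x \<le> 9/4}"
  have minus_C: "uminus ` C = B \<inter> {x. d2 \<bullet> x \<ge> - 9/4}"
  proof (intro equalityI subsetI)
    fix x assume "x \<in> B \<inter> {x. d2 \<bullet> x \<ge> - 9/4}"
    then have "- x \<in> C" using uminus_B by (auto simp: C_def)
    then show "x \<in> uminus ` C" by (metis image_eqI minus_minus)
  qed (use uminus_B in \<open>auto simp: C_def\<close>)
  have box: "\<bar>x $ i\<bar> \<le> 1" "\<bar>x $ j\<bar> \<le> 1" if "x \<in> B" for x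
    using that by (metis mem_B r_simps(1), metis mem_B r_simps(2))
  have Un: "A \<union> C = B"
  proof -
    have "d1 \<bullet> x \<le> 9/4 \<or> d2 \<bullet> x \<le> 9/4" if "x \<in> B" for x
    proof -
      have "x $ i + x $ j \<le> 3/2" using that unfolding mem_B by linarith
      then show ?thesis unfolding inner by linarith
    qed
    then show ?thesis by (auto simp: A_def C_def)
  qed
  have Un': "A \<union> uminus ` C = B"
  proof -
    have "d1 \<bullet> x \<le> 9/4 \<or> - 9/4 \<le> d2 \<bullet> x" if "x \<in> B" for x
      using box[OF that] unfolding inner by linarith
    then show ?thesis unfolding minus_C by (auto simp: A_def)
  qed
  have poly: "polytope B"
    unfolding B_def
    by (intro polytope_Int_polyhedron polytope_interval polyhedron_halfspace_le polyhedron_halfspace_ge)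
  have polyA: "polytope A" and polyC: "polytope C" and polyC': "polytope (uminus ` C)"
    unfolding minus_C unfolding A_def C_def using poly
    by (intro polytope_Int_polyhedron polyhedron_halfspace_le polyhedron_halfspace_ge; assumption)+
  have polyK: "polytope (A \<inter> C)" and polyL: "polytope (A \<inter> uminus ` C)"
    using polyA polyC polyC' by (auto intro: polytope_Int)
  have "0 \<in> interior (A \<inter> C) \<and> 0 \<in> interior (A \<inter> uminus ` C)"
  proof -
    have "x \<in> A \<inter> C \<inter> uminus ` C" if "x \<in> ball 0 (1 / N)" for x
    proof -
      have small: "\<bar>x $ k\<bar> \<le> 1 / N" for k
        using component_le_norm_cart[of x k] that by simp
      have "1 / N \<le> 1 / 2" using N by (simp add: field_simps)
      from order_trans[OF small this] have half: "\<bar>x $ k\<bar> \<le> 1 / 2" for k .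
      have "\<bar>x $ k\<bar> \<le> r $ k" for k
        using small[of k] half[of k] by (simp add: r_def)
      moreover have "\<bar>x $ i + x $ j\<bar> \<le> 3/2" "2 * x $ i + x $ j \<le> 9/4"
          "x $ i + 2 * x $ j \<le> 9/4" "- 9/4 \<le> x $ i + 2 * x $ j"
        using half[of i] half[of j] by linarith+
      ultimately show ?thesis
        unfolding minus_C by (simp add: A_def C_def mem_B inner)
    qed
    then have "ball 0 (1 / N) \<subseteq> A \<inter> C" "ball 0 (1 / N) \<subseteq> A \<inter> uminus ` C" by blast+
    then show ?thesis using N by (auto simp: mem_interior intro!: exI[of _ "1 / N"])
  qed
  then have bodies: "convex_body (A \<inter> C)" "convex_body (A \<inter> uminus ` C)"
    using polyK polyL by (simp_all add: convex_body_def polytope_imp_compact polytope_imp_convex)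
  have "\<not> congruent_sets (A \<inter> C) (A \<inter> uminus ` C)"
  proof (rule not_congruent_if_opposite_cuts)
    define p :: "real ^ 'n" where "p = (\<chi> k. if k = j then - 1 else r $ k)"
    have p: "p $ i = 1" "p $ j = - 1" "\<And>k. \<bar>p $ k\<bar> = r $ k"
      using ij N by (auto simp: p_def r_def)
    show "p \<in> A \<inter> C" "- p \<in> A \<inter> C"
      using p by (auto simp: A_def C_def mem_B inner)
    have "norm x \<le> norm p" if "x \<in> B" for x
      using that p(3) by (intro norm_le_componentwise_cart) (auto simp: mem_B)
    then show "A \<inter> uminus ` C \<subseteq> cball 0 (norm p)" by (force simp: A_def)
  next
    have cap: "x \<in> B \<and> x $ i > 1/4 \<and> x $ j > 1/4"
      if "x \<notin> A \<inter> C" "- x \<in> A \<inter> C" for x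
    proof -
      have "x \<in> B" using that(2) uminus_B[of "- x"] by (simp add: A_def)
      moreover from this that(1) have "d1 \<bullet> x > 9/4 \<or> d2 \<bullet> x > 9/4" by (auto simp: A_def C_def)
      ultimately show ?thesis using box[of x] unfolding inner by linarith
    qed
    fix x y assume "x \<notin> A \<inter> C" "- x \<in> A \<inter> C" "y \<notin> A \<inter> C" "- y \<in> A \<inter> C"
    then have x: "x \<in> B" "x $ i > 1/4" "x $ j > 1/4" and y: "y \<in> B" "y $ i > 1/4" "y $ j > 1/4"
      using cap[of x] cap[of y] by auto
    have "x $ k * y $ k \<ge> - ((1 / N) * (1 / N))" if "k \<notin> {i, j}" for k
    proof -
      have "\<bar>x $ k\<bar> \<le> 1 / N" "\<bar>y $ k\<bar> \<le> 1 / N"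
        using x(1) y(1) r_simps(3)[of k] that by (auto simp: mem_B dest!: spec[of _ k])
      then have "\<bar>x $ k * y $ k\<bar> \<le> (1 / N) * (1 / N)"
        unfolding abs_mult using N by (intro mult_mono) auto
      then show ?thesis by (simp add: abs_le_iff)
    qed
    then have "(\<Sum>k\<in>UNIV - {i, j}. - ((1 / N) * (1 / N))) \<le> (\<Sum>k\<in>UNIV - {i, j}. x $ k * y $ k)"
      by (intro sum_mono) auto
    moreover have "(\<Sum>k\<in>UNIV - {i, j}. - ((1 / N) * (1 / N))) = - ((N - 2) * ((1 / N) * (1 / N)))"
      using ij assms by (simp add: card_Diff_subset N_def of_nat_diff)
    moreover have "(N - 2) * ((1 / N) * (1 / N)) \<le> 1 / 8"
    proof -
      \<comment> \<open>This is the inequality \<open>(N - 4)\<^sup>2 \<ge> 0\<close>; it is what the side length 1 / N of the cube is for.\<close>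
      have "8 * (N - 2) \<le> N * N"
        using zero_le_power2[of "N - 4"] by (simp add: power2_eq_square algebra_simps)
      then show ?thesis using N by (simp add: field_simps)
    qed
    moreover have "(1/4) * (1/4) \<le> x $ i * y $ i" "(1/4) * (1/4) \<le> x $ j * y $ j"
      using x y by (intro mult_mono; simp)+
    moreover have "x \<bullet> y = (\<Sum>k\<in>UNIV - {i, j}. x $ k * y $ k) + (x $ i * y $ i + x $ j * y $ j)"
      using ij sum.subset_diff[of "{i, j}" UNIV "\<lambda>k. x $ k * y $ k"] by (simp add: inner_vec_def)
    ultimately show "x \<bullet> y \<ge> 0" by linarith
  next
    define x y :: "real ^ 'n" where "x = axis i 1 + (1/2) *\<^sub>R axis j 1"
      and "y = - ((1/2) *\<^sub>R axis i 1 + axis j 1)"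
    have x: "x $ i = 1" "x $ j = 1/2" "\<And>k. \<bar>x $ k\<bar> \<le> r $ k"
      and y: "y $ i = - (1/2)" "y $ j = - 1" "\<And>k. \<bar>y $ k\<bar> \<le> r $ k"
      using ij N by (auto simp: x_def y_def r_def axis_def)
    show "x \<notin> A \<inter> uminus ` C" "- x \<in> A \<inter> uminus ` C" "y \<notin> A \<inter> uminus ` C" "- y \<in> A \<inter> uminus ` C"
      unfolding minus_C using x y by (auto simp: A_def mem_B inner)
    have "x \<bullet> y = - 1"
      using y by (simp add: x_def inner_add_left inner_axis')
    then show "x \<bullet> y < 0" by simp
  qed
  with bodies show ?thesis
    using polyA polyC polyK polyL poly Un Un'
    by (intro exI[of _ "A \<inter> C"] exI[of _ "A \<inter> uminus ` C"] conjI noncongruent_with_equal_sectionsI)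
      (simp_all add: polytope_imp_compact polytope_imp_convex)
qed

section \<open>The theorem\<close>

theorem theorem2p4:
  assumes "CARD('n::finite) \<ge> 2"
  shows "(\<exists>K L :: (real ^ 'n) set. noncongruent_with_equal_sections K L) \<and>
    (\<exists>K L :: (real ^ 'n) set. noncongruent_with_equal_sections K L \<and>
        C_infinity_plus K \<and> body_of_revolution K \<and> C_infinity_plus L \<and> body_of_revolution L) \<and>
    (\<exists>K L :: (real ^ 'n) set. noncongruent_with_equal_sections K L \<and> polytope K \<and> polytope L)"
proof -
  obtain i j :: 'n where "i \<noteq> j"
    using assms card_le_Suc0_iff_eq[of "UNIV :: 'n set"] by auto
  then have "axis i 1 \<bullet> (axis i 1 :: real ^ 'n) = 1" "axis j 1 \<bullet> (axis j 1 :: real ^ 'n) = 1"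
      "axis i 1 \<bullet> (axis j 1 :: real ^ 'n) = 0"
    by (simp_all add: inner_axis_axis)
  from exists_smooth_pair[OF this] exists_polytope_pair[OF assms] show ?thesis by blast
qed

end
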